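(* Let $\ell\ge2$ and $d\ge1$ be integers and set $e=\ell d$. Let $\mathcal U^\ell$ and $\mathcal U^e$ be the sets of all charged $\ell$-partitions and all charged $e$-partitions. Then, as maps $\mathcal U^\ell\to\mathcal U^e$, $$\mathrm{LR}\circ\mathsf t_{d\boldsymbol\rho}=\mathsf t_{\boldsymbol\rho^d_{\mathrm{rev}}}\circ\mathrm{sLR},$$ where $\mathrm{LR}$ is the level-rank duality, $\mathrm{sLR}$ is the spetsial level-rank duality, $\mathsf t_{d\boldsymbol\rho}:\mathcal U^\ell\to\mathcal U^\ell$ is $|\boldsymbol\lambda,\boldsymbol\sigma\rangle\mapsto|\boldsymbol\lambda,\boldsymbol\sigma+d\boldsymbol\rho\rangle$, and $\mathsf t_{\boldsymbol\rho^d_{\mathrm{rev}}}:\mathcal U^e\to\mathcal U^e$ is $|\boldsymbol\mu,\boldsymbol\tau\rangle\mapsto|\boldsymbol\mu,\boldsymbol\tau+\boldsymbol\rho^d_{\mathrm{rev}}\rangle$.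
   Context: A charged $\ell$-partition $|\boldsymbol\lambda,\boldsymbol\sigma\rangle$ is a pair of an $\ell$-tuple of partitions $\boldsymbol\lambda=(\lambda^1,\dots,\lambda^\ell)$ and a charge $\boldsymbol\sigma\in\mathbb Z^\ell$. It is identified with its abacus: the subset $\{(\beta,j):\beta\in S^{(j)}\}$ of $\mathbb Z\times\{1,\dots,\ell\}$, where $S^{(j)}=\{\lambda^j_k-k+1+\sigma_j : k\ge1\}$ (row $j$, column $\beta$; rows numbered from bottom to top). This gives a bijection between charged $\ell$-partitions and subsets of $\mathbb Z\times\{1,\dots,\ell\}$ each of whose rows contains all sufficiently negative and no sufficiently large integers. $\boldsymbol\rho=(0,1,\dots,\ell-1)\in\mathbb Z^\ell$, and $\boldsymbol\rho^d_{\mathrm{rev}}\in\mathbb Z^e$ is the sequence $(\ell-1,\dots,\ell-1,\ \dots,\ 1,\dots,1,\ 0,\dots,0)$ in which each of $\ell-1,\dots,1,0$ is repeated $d$ times. LR is induced on abaci by the bijection $\mathbb Z\times\{1,\dots,\ell\}\to\mathbb Z\times\{1,\dots,e\}$, $(k,j)\mapsto\left(\ell(\lfloor\frac{k-1}{e}\rfloor+1)-j+1,\ ((k-1)\bmod e)+1\right)$. sLR is the following procedure on abaci. Tile the $\ell$-abacus by big rectangles of width $d\ell$ and height $\ell$, with $0$ in the rightmost column of its rectangle; subdivide each into horizontal dominoes of width $d$ and height 1, giving $\ell$ domino-columns numbered $1,\dots,\ell$ from left to right. For each $i$, rotate the $i$-th domino-column of every big rectangle cyclically upwards by $i-1$.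 Then rotate each domino counterclockwise by 90 degrees to get an $\ell d$-abacus, whose column $0$ consists of the rotated dominoes that contained position $0$. Explicitly, sLR is induced by the map $(\beta,j)\mapsto\left(u+1,\ d\cdot((j-1+u)\bmod\ell)+r+1\right)$, where $u=\lfloor\frac{\beta-1}{d}\rfloor$ and $r=(\beta-1)\bmod d$. *)

theory Defs
  imports Main
begin

text \<open>A partition is the list of its nonzero parts in weakly decreasing order; thus equality of
  lists is equality of partitions. \<open>part \<alpha> k\<close> is the \<open>k\<close>-th part for \<open>k \<ge> 1\<close>, and is \<open>0\<close>
  beyond the length.\<close>

definition is_partition :: "nat list \<Rightarrow> bool" where
  "is_partition \<alpha> \<longleftrightarrow> sorted_wrt (\<ge>) \<alpha> \<and> 0 \<notin> set \<alpha>"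

definition part :: "nat list \<Rightarrow> nat \<Rightarrow> nat" where
  "part \<alpha> k = (if k \<le> length \<alpha> then \<alpha> ! (k - 1) else 0)"

text \<open>Tuples are lists, so the component with (one-based) index \<open>j\<close> is \<open>xs ! (j - 1)\<close>.\<close>

type_synonym charged = "nat list list \<times> int list"

definition charged_partitions :: "nat \<Rightarrow> charged set" where
  "charged_partitions l =
     {(\<Lambda>, \<sigma>). length \<Lambda> = l \<and> length \<sigma> = l \<and> (\<forall>\<alpha>\<in>set \<Lambda>. is_partition \<alpha>)}"

definition beta_set :: "nat list \<Rightarrow> int \<Rightarrow> int set" where
  "beta_set \<alpha> s = {int (part \<alpha> k) - int k + 1 + s |k. k \<ge> 1}"

text \<open>Positions of an abacus are pairs (column, row).\<close>

fun abacus :: "charged \<Rightarrow> (int \<times> nat) set" where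
  "abacus (\<Lambda>, \<sigma>) =
     {(\<beta>, j). j \<in> {1..length \<Lambda>} \<and> \<beta> \<in> beta_set (\<Lambda> ! (j - 1)) (\<sigma> ! (j - 1))}"

definition abaci :: "nat \<Rightarrow> (int \<times> nat) set set" where
  "abaci l = {A. A \<subseteq> UNIV \<times> {1..l} \<and>
     (\<forall>j\<in>{1..l}. (\<exists>N. \<forall>\<beta><N. (\<beta>, j) \<in> A) \<and> (\<exists>N. \<forall>\<beta>>N. (\<beta>, j) \<notin> A))}"

text \<open>The inverse of the bijection \<open>abacus\<close> from charged \<open>l\<close>-partitions to abaci with \<open>l\<close> rows
  (see \<open>bij_betw_abacus\<close> below).\<close>

definition of_abacus :: "nat \<Rightarrow> (int \<times> nat) set \<Rightarrow> charged" where
  "of_abacus l = the_inv_into (charged_partitions l) abacus"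

definition LR_pos :: "nat \<Rightarrow> nat \<Rightarrow> int \<times> nat \<Rightarrow> int \<times> nat" where
  "LR_pos l e = (\<lambda>(k, j).
     (int l * ((k - 1) div int e + 1) - int j + 1, nat ((k - 1) mod int e) + 1))"

definition LR :: "nat \<Rightarrow> nat \<Rightarrow> charged \<Rightarrow> charged" where
  "LR l e x = of_abacus e (LR_pos l e ` abacus x)"

text \<open>Cut the rows into dominoes \<open>{d * u + 1, \<dots>, d * u + d}\<close>, \<open>u\<close> being an integer, and group \<open>l\<close>
  consecutive domino columns into a big rectangle, so that \<open>u mod l + 1\<close> is the number of the domino
  column within its rectangle. That column is rotated upwards by \<open>u mod l\<close>; then each domino is turned
  counterclockwise by 90 degrees, so that it occupies \<open>d\<close> rows of the single column \<open>u + 1\<close>, its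
  leftmost position (\<open>r = 0\<close>) going to the bottom. Rows are numbered from bottom to top.\<close>

definition sLR_pos :: "nat \<Rightarrow> nat \<Rightarrow> int \<times> nat \<Rightarrow> int \<times> nat" where
  "sLR_pos l d = (\<lambda>(\<beta>, j).
     let u = (\<beta> - 1) div int d; r = (\<beta> - 1) mod int d
     in (u + 1, d * nat ((int j - 1 + u) mod int l) + nat r + 1))"

definition sLR :: "nat \<Rightarrow> nat \<Rightarrow> charged \<Rightarrow> charged" where
  "sLR l d x = of_abacus (l * d) (sLR_pos l d ` abacus x)"

definition shift_charge :: "int list \<Rightarrow> charged \<Rightarrow> charged" where
  "shift_charge v = (\<lambda>(\<Lambda>, \<sigma>). (\<Lambda>, map2 (+) \<sigma> v))"

definition rho :: "nat \<Rightarrow> int list" where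
  "rho l = map int [0..<l]"

definition rho_rev :: "nat \<Rightarrow> nat \<Rightarrow> int list" where
  "rho_rev l d = concat (map (\<lambda>m. replicate d (int m)) (rev [0..<l]))"


subsection \<open>The abacus bijection\<close>

lemma part_antimono:
  assumes "is_partition \<alpha>" "1 \<le> i" "i \<le> k"
  shows "part \<alpha> k \<le> part \<alpha> i"
proof (cases "k \<le> length \<alpha> \<and> i < k")
  case True
  then show ?thesis using assms
    by (auto simp: is_partition_def part_def sorted_wrt_iff_nth_less)
next
  case False
  then show ?thesis using assms by (auto simp: part_def)
qed

lemma part_pos_iff:
  assumes "is_partition \<alpha>" "1 \<le> k"
  shows "part \<alpha> k > 0 \<longleftrightarrow> k \<le> length \<alpha>"
  using assms by (force simp: is_partition_def part_def in_set_conv_nth)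

lemma strict_decreasing_range_unique:
  fixes f g :: "nat \<Rightarrow> int"
  assumes f: "\<And>i k. i < k \<Longrightarrow> f k < f i" and g: "\<And>i k. i < k \<Longrightarrow> g k < g i"
    and R: "range f = range g"
  shows "f = g"
proof
  fix k
  show "f k = g k"
  proof (induction k rule: less_induct)
    case (less k)
    have 1: "f k \<le> g k"
    proof -
      obtain m where m: "f k = g m" using R by (metis rangeE rangeI)
      have "\<not> m < k" using less m f by (metis less_irrefl)
      then show ?thesis using m g[of k m] by (cases "m = k") auto
    qed
    have "g k \<le> f k"
    proof -
      obtain m where m: "g k = f m" using R by (metis rangeE rangeI)
      have "\<not> m < k" using less m g by (metis less_irrefl)
      then show ?thesis using m f[of k m] by (cases "m = k") auto
    qed
    with 1 show ?case by simp
  qed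
qed

lemma beta_set_range: "beta_set \<alpha> s = range (\<lambda>k. int (part \<alpha> (Suc k)) - int k + s)"
proof -
  have "{k. k \<ge> 1} = range Suc" by (auto simp: image_iff) (metis Suc_le_D)
  then have "beta_set \<alpha> s = (\<lambda>k. int (part \<alpha> k) - int k + 1 + s) ` range Suc"
    by (auto simp: beta_set_def)
  then show ?thesis by (simp add: image_image)
qed

lemma beta_set_inj:
  assumes p: "is_partition \<alpha>" "is_partition \<mu>" and eq: "beta_set \<alpha> s = beta_set \<mu> t"
  shows "\<alpha> = \<mu> \<and> s = t"
proof -
  have dec: "int (part \<nu> (Suc k)) - int k + c < int (part \<nu> (Suc i)) - int i + c"
    if "is_partition \<nu>" "i < k" for \<nu> c i k
    using part_antimono[OF that(1), of "Suc i" "Suc k"] that(2) by simp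
  have "(\<lambda>k. int (part \<alpha> (Suc k)) - int k + s) = (\<lambda>k. int (part \<mu> (Suc k)) - int k + t)"
    using eq unfolding beta_set_range
    by (intro strict_decreasing_range_unique) (use dec p in auto)
  then have k: "int (part \<alpha> (Suc k)) + s = int (part \<mu> (Suc k)) + t" for k
    by (auto dest!: fun_cong[of _ _ k])
  have st: "s = t"
    using k[of "length \<alpha> + length \<mu>"] by (simp add: part_def)
  have pk: "part \<alpha> k = part \<mu> k" if "k \<ge> 1" for k
    using k[of "k - 1"] st that by simp
  have "k \<le> length \<alpha> \<longleftrightarrow> k \<le> length \<mu>" if "k \<ge> 1" for k
    using pk part_pos_iff p that by metis
  then have len: "length \<alpha> = length \<mu>"
    by (metis One_nat_def Suc_leI le_antisym le_zero_eq nat_le_linear not_gr_zero)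
  have "\<alpha> = \<mu>"
  proof (rule nth_equalityI[OF len])
    fix i assume "i < length \<alpha>"
    then show "\<alpha> ! i = \<mu> ! i" using pk[of "Suc i"] len by (simp add: part_def)
  qed
  with st show ?thesis by simp
qed

lemma beta_set_Nil: "beta_set [] s = {..s}"
proof -
  have "x \<in> range (\<lambda>k. s - int k)" if "x \<le> s" for x
    using that by (intro image_eqI[of _ _ "nat (s - x)"]) auto
  then show ?thesis by (auto simp: beta_set_range part_def)
qed

lemma beta_set_Cons: "beta_set (a # \<alpha>) (s + 1) = insert (int a + s + 1) (beta_set \<alpha> s)"
proof -
  have "range (\<lambda>k. int (part (a # \<alpha>) (Suc k)) - int k + (s + 1)) =
    insert (int a + s + 1)
      (range (\<lambda>k. int (part (a # \<alpha>) (Suc (Suc k))) - int (Suc k) + (s + 1)))"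
    (is "range ?f = insert _ ?R")
  proof -
    have "k \<in> insert 0 (range Suc)" for k by (cases k) auto
    then have U: "(UNIV :: nat set) = insert 0 (range Suc)" by blast
    have "range ?f = insert (?f 0) (?f ` range Suc)"
      by (rule trans[OF arg_cong[where f = "image ?f", OF U] image_insert])
    moreover have "?f 0 = int a + s + 1" by (simp add: part_def)
    moreover have "?f ` range Suc = ?R" by (simp only: image_image)
    ultimately show ?thesis by (simp only:)
  qed
  also have "?R = beta_set \<alpha> s"
  proof -
    have "part (a # \<alpha>) (Suc (Suc k)) = part \<alpha> (Suc k)" for k by (simp add: part_def)
    then show ?thesis by (simp add: beta_set_range algebra_simps)
  qed
  finally show ?thesis by (simp add: beta_set_range)
qed

lemma beta_set_surj_aux:
  assumes "finite F" "\<forall>x\<in>F. N < x"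
  shows "\<exists>\<alpha> s. is_partition \<alpha> \<and> beta_set \<alpha> s = {..N::int} \<union> F"
  using assms
proof (induction F rule: finite_linorder_max_induct)
  case empty
  have "is_partition []" by (simp add: is_partition_def)
  then show ?case using beta_set_Nil[of N] by auto
next
  case (insert b F)
  then obtain \<alpha> s where p: "is_partition \<alpha>" and S: "beta_set \<alpha> s = {..N} \<union> F" by auto
  have top: "int (part \<alpha> 1) + s < b"
  proof -
    have "int (part \<alpha> 1) - int 1 + 1 + s \<in> beta_set \<alpha> s"
      unfolding beta_set_def by blast
    then show ?thesis using S insert by auto
  qed
  define a where "a = nat (b - s - 1)"
  have a: "int a = b - s - 1" "part \<alpha> 1 \<le> a" using top by (auto simp: a_def)
  show ?case
  proof (cases "a = 0")
    case True
    then have "\<alpha> = []" using a part_pos_iff[OF p, of 1] by (cases \<alpha>) auto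
    then have "beta_set [] (s + 1) = insert b (beta_set \<alpha> s)"
      using True a by (auto simp: beta_set_Nil)
    then have "beta_set [] (s + 1) = {..N} \<union> insert b F" using S by simp
    then show ?thesis using p \<open>\<alpha> = []\<close> by blast
  next
    case False
    have "x \<le> a" if x: "x \<in> set \<alpha>" for x
    proof -
      obtain i where i: "i < length \<alpha>" "x = \<alpha> ! i" using x by (metis in_set_conv_nth)
      have "part \<alpha> (Suc i) \<le> part \<alpha> 1" by (rule part_antimono[OF p]) auto
      moreover have "part \<alpha> (Suc i) = x" using i by (simp add: part_def)
      ultimately show ?thesis using a(2) by (metis order_trans)
    qed
    then have "is_partition (a # \<alpha>)" using False p by (auto simp: is_partition_def)
    moreover have "beta_set (a # \<alpha>) (s + 1) = {..N} \<union> insert b F"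
      using a S by (simp add: beta_set_Cons)
    ultimately show ?thesis by blast
  qed
qed

lemma beta_set_surj:
  assumes "\<forall>\<beta><N. \<beta> \<in> S" "\<forall>\<beta>>M. \<beta> \<notin> S"
  shows "\<exists>\<alpha> s. is_partition \<alpha> \<and> beta_set \<alpha> s = S"
proof -
  have fin: "finite (S \<inter> {N..})"
    by (rule finite_subset[of _ "{N..M}"]) (use assms(2) in \<open>auto simp flip: not_less\<close>)
  have "\<exists>\<alpha> s. is_partition \<alpha> \<and> beta_set \<alpha> s = {..N - 1} \<union> (S \<inter> {N..})"
    by (rule beta_set_surj_aux) (use fin in auto)
  moreover have "{..N - 1} \<union> (S \<inter> {N..}) = S" using assms(1) by auto
  ultimately show ?thesis by simp
qed

lemma beta_set_bounds:
  assumes "is_partition \<alpha>"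
  shows "\<exists>N. \<forall>\<beta><N. \<beta> \<in> beta_set \<alpha> s" "\<exists>N. \<forall>\<beta>>N. \<beta> \<notin> beta_set \<alpha> s"
proof -
  have "\<beta> \<in> beta_set \<alpha> s" if "\<beta> < s - int (length \<alpha>)" for \<beta>
    unfolding beta_set_range
    by (rule image_eqI[of _ _ "nat (s - \<beta>)"]) (use that in \<open>auto simp: part_def\<close>)
  then show "\<exists>N. \<forall>\<beta><N. \<beta> \<in> beta_set \<alpha> s" by blast
  have "\<beta> \<le> int (part \<alpha> 1) + s" if \<beta>: "\<beta> \<in> beta_set \<alpha> s" for \<beta>
  proof -
    obtain k where "\<beta> = int (part \<alpha> (Suc k)) - int k + s"
      using \<beta> by (auto simp: beta_set_range)
    then show ?thesis using part_antimono[OF assms, of 1 "Suc k"] by simp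
  qed
  then show "\<exists>N. \<forall>\<beta>>N. \<beta> \<notin> beta_set \<alpha> s" by (meson not_less)
qed

lemma bij_betw_abacus: "bij_betw abacus (charged_partitions l) (abaci l)"
proof (rule bij_betw_imageI)
  show "inj_on abacus (charged_partitions l)"
  proof (rule inj_onI)
    fix x y assume x: "x \<in> charged_partitions l" and y: "y \<in> charged_partitions l"
      and eq: "abacus x = abacus y"
    obtain L s where [simp]: "x = (L, s)" by (cases x)
    obtain M t where [simp]: "y = (M, t)" by (cases y)
    have "L ! i = M ! i \<and> s ! i = t ! i" if "i < l" for i
    proof (rule beta_set_inj)
      show "is_partition (L ! i)" "is_partition (M ! i)"
        using x y that by (auto simp: charged_partitions_def)
      have "(\<beta>, Suc i) \<in> abacus x \<longleftrightarrow> (\<beta>, Suc i) \<in> abacus y" for \<beta>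
        by (simp only: eq)
      then show "beta_set (L ! i) (s ! i) = beta_set (M ! i) (t ! i)"
        using x y that by (auto simp: charged_partitions_def)
    qed
    then show "x = y"
      using x y by (auto simp: charged_partitions_def intro: nth_equalityI)
  qed
  have "abacus x \<in> abaci l" if x: "x \<in> charged_partitions l" for x
  proof -
    obtain L s where [simp]: "x = (L, s)" by (cases x)
    have "is_partition (L ! (j - 1))" if "j \<in> {1..l}" for j
      using x that by (auto simp: charged_partitions_def)
    then show ?thesis
      using x beta_set_bounds by (auto simp: charged_partitions_def abaci_def)
  qed
  moreover have "A \<in> abacus ` charged_partitions l" if A: "A \<in> abaci l" for A
  proof -
    have "\<exists>\<alpha> s. is_partition \<alpha> \<and> beta_set \<alpha> s = {\<beta>. (\<beta>, j) \<in> A}" if j: "j \<in> {1..l}" for j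
    proof -
      from A j obtain N M where "\<forall>\<beta><N. (\<beta>, j) \<in> A" "\<forall>\<beta>>M. (\<beta>, j) \<notin> A"
        unfolding abaci_def by blast
      then show ?thesis by (intro beta_set_surj) auto
    qed
    then obtain P c where P: "\<And>j. j \<in> {1..l} \<Longrightarrow>
        is_partition (P j) \<and> beta_set (P j) (c j) = {\<beta>. (\<beta>, j) \<in> A}" by metis
    define x where "x = (map (\<lambda>i. P (Suc i)) [0..<l], map (\<lambda>i. c (Suc i)) [0..<l])"
    have "x \<in> charged_partitions l" using P by (auto simp: x_def charged_partitions_def)
    moreover have "abacus x = A"
    proof -
      have "(\<beta>, j) \<in> abacus x \<longleftrightarrow> j \<in> {1..l} \<and> (\<beta>, j) \<in> A" for \<beta> j
        using P[of j] by (auto simp: x_def)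
      moreover have "A \<subseteq> UNIV \<times> {1..l}" using A by (simp add: abaci_def)
      ultimately show ?thesis by auto
    qed
    ultimately show ?thesis by blast
  qed
  ultimately show "abacus ` charged_partitions l = abaci l" by blast
qed

lemma of_abacus_in: "A \<in> abaci l \<Longrightarrow> of_abacus l A \<in> charged_partitions l"
  using bij_betw_abacus[of l] unfolding of_abacus_def
  by (metis bij_betw_def bij_betw_the_inv_into image_eqI)

lemma abacus_of_abacus: "A \<in> abaci l \<Longrightarrow> abacus (of_abacus l A) = A"
  using bij_betw_abacus[of l] unfolding of_abacus_def by (rule f_the_inv_into_f_bij_betw)


subsection \<open>The maps are well defined\<close>

lemma abaci_image:
  fixes a b K :: int
  assumes A: "A \<in> abaci l" and pos: "a > 0" "b > 0"
    and into: "\<And>p. p \<in> UNIV \<times> {1..l} \<Longrightarrow> f p \<in> UNIV \<times> {1..m}"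
    and surj: "\<And>q. q \<in> UNIV \<times> {1..m} \<Longrightarrow> \<exists>p\<in>UNIV \<times> {1..l}. f p = q"
    and bd: "\<And>p. p \<in> UNIV \<times> {1..l} \<Longrightarrow> \<bar>a * fst (f p) - b * fst p\<bar> \<le> K"
  shows "f ` A \<in> abaci m"
proof -
  have sub: "A \<subseteq> UNIV \<times> {1..l}" using A by (simp add: abaci_def)
  from A have "\<forall>j\<in>{1..l}. \<exists>N. \<forall>\<beta><N. (\<beta>, j) \<in> A" "\<forall>j\<in>{1..l}. \<exists>N. \<forall>\<beta>>N. (\<beta>, j) \<notin> A"
    by (simp_all add: abaci_def)
  then obtain N M where N: "\<And>j \<beta>. j \<in> {1..l} \<Longrightarrow> \<beta> < N j \<Longrightarrow> (\<beta>, j) \<in> A"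
    and M: "\<And>j \<beta>. j \<in> {1..l} \<Longrightarrow> \<beta> > M j \<Longrightarrow> (\<beta>, j) \<notin> A"
    by metis
  define B where "B = (\<Sum>j\<in>{1..l}. \<bar>N j\<bar> + \<bar>M j\<bar>)"
  have B: "\<bar>N j\<bar> + \<bar>M j\<bar> \<le> B" if "j \<in> {1..l}" for j
    unfolding B_def by (rule member_le_sum) (use that in auto)
  define C where "C = b * (\<bar>B\<bar> + 1) + \<bar>K\<bar>"
  have low: "(x, y) \<in> f ` A" if y: "y \<in> {1..m}" and x: "x < - C" for x y
  proof -
    obtain p where p: "p \<in> UNIV \<times> {1..l}" "f p = (x, y)" using surj[of "(x, y)"] y by auto
    have C0: "C \<ge> 0" using pos by (simp add: C_def)
    have "a * x \<le> 1 * x" using pos x C0 by (intro mult_right_mono_neg) auto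
    then have "b * fst p < - (b * (\<bar>B\<bar> + 1))"
      using bd[OF p(1)] p(2) x by (simp add: C_def)
    then have "b * fst p < b * (- (\<bar>B\<bar> + 1))" by (simp only: mult_minus_right)
    then have "fst p < - (\<bar>B\<bar> + 1)" using pos by (simp only: mult_less_cancel_left_pos)
    then have "fst p < N (snd p)" using B[of "snd p"] p(1) by auto
    then have "p \<in> A" using N[of "snd p" "fst p"] p(1) by auto
    then show ?thesis using p(2) by force
  qed
  have high: "(x, y) \<notin> f ` A" if x: "x > C" for x y
  proof
    assume "(x, y) \<in> f ` A"
    then obtain p where p: "p \<in> A" "f p = (x, y)" by auto
    then have pl: "p \<in> UNIV \<times> {1..l}" using sub by blast
    have C0: "C \<ge> 0" using pos by (simp add: C_def)
    have "1 * x \<le> a * x" using pos x C0 by (intro mult_right_mono) auto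
    then have "b * fst p > b * (\<bar>B\<bar> + 1)"
      using bd[OF pl] p(2) x by (simp add: C_def)
    then have "fst p > \<bar>B\<bar> + 1" using pos by (simp only: mult_less_cancel_left_pos)
    then have "fst p > M (snd p)" using B[of "snd p"] pl by auto
    then show False using M[of "snd p" "fst p"] p(1) pl by auto
  qed
  show ?thesis unfolding abaci_def using low high into sub by blast
qed

lemma LR_pos_abaci:
  assumes A: "A \<in> abaci l" and "l > 0" "e > 0"
  shows "LR_pos l e ` A \<in> abaci e"
proof (rule abaci_image[OF A, where a = "int e" and b = "int l" and K = "2 * int e * int l"])
  show "int e > 0" "int l > 0" using assms by auto
next
  fix p :: "int \<times> nat" assume p: "p \<in> UNIV \<times> {1..l}"
  obtain k j where [simp]: "p = (k, j)" by (cases p)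
  define q r where "q = (k - 1) div int e" and "r = (k - 1) mod int e"
  have k: "k = int e * q + r + 1" and r: "0 \<le> r" "r < int e"
    using assms by (auto simp: q_def r_def)
  have f: "LR_pos l e p = (int l * (q + 1) - int j + 1, nat r + 1)"
    by (simp add: LR_pos_def q_def r_def)
  show "LR_pos l e p \<in> UNIV \<times> {1..e}" unfolding f using r by (simp add: nat_less_iff Suc_le_eq)
  have j: "0 \<le> int j - 1" "int j - 1 \<le> int l" using p by auto
  have eq: "int e * fst (LR_pos l e p) - int l * fst p
      = int e * int l - int e * (int j - 1) - int l * (r + 1)"
    unfolding f by (simp add: k algebra_simps)
  have "0 \<le> int e * (int j - 1)" "int e * (int j - 1) \<le> int e * int l"
    using j by (auto intro: mult_left_mono)
  moreover have "0 \<le> int l * (r + 1)" "int l * (r + 1) \<le> int l * int e"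
    using r by (auto intro: mult_left_mono)
  moreover have "int l * int e = int e * int l" by simp
  ultimately show "\<bar>int e * fst (LR_pos l e p) - int l * fst p\<bar> \<le> 2 * int e * int l"
    unfolding eq by linarith
next
  fix y :: "int \<times> nat" assume y: "y \<in> UNIV \<times> {1..e}"
  obtain c i where [simp]: "y = (c, i)" by (cases y)
  define m where "m = (- c) mod int l"
  define q where "q = - ((- c) div int l) - 1"
  have m: "0 \<le> m" "m < int l" using assms by (auto simp: m_def)
  have "- c = int l * ((- c) div int l) + m" unfolding m_def by (rule mult_div_mod_eq[symmetric])
  then have c: "c = int l * (q + 1) - m" by (simp add: q_def algebra_simps)
  have "(int e * q + (int i - 1)) div int e = q" "(int e * q + (int i - 1)) mod int e = int i - 1"
    using y by (auto simp: div_add1_eq mod_pos_pos_trivial div_pos_pos_trivial)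
  moreover have "int e * q + int i - 1 = int e * q + (int i - 1)" by simp
  ultimately have "LR_pos l e (int e * q + int i, nat m + 1)
      = (int l * (q + 1) - int (nat m + 1) + 1, nat (int i - 1) + 1)"
    unfolding LR_pos_def prod.case by (simp only:)
  also have "\<dots> = y" using y m c by (simp add: nat_diff_distrib)
  finally have "LR_pos l e (int e * q + int i, nat m + 1) = y" .
  moreover have "(int e * q + int i, nat m + 1) \<in> UNIV \<times> {1..l}"
    using m by (simp add: nat_less_iff Suc_le_eq)
  ultimately show "\<exists>p\<in>UNIV \<times> {1..l}. LR_pos l e p = y" by blast
qed

lemma sLR_pos_abaci:
  assumes A: "A \<in> abaci l" and "l > 0" "d > 0"
  shows "sLR_pos l d ` A \<in> abaci (l * d)"
proof (rule abaci_image[OF A, where a = "int d" and b = 1 and K = "int d"])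
  show "int d > 0" "(1::int) > 0" using assms by auto
next
  fix p :: "int \<times> nat" assume p: "p \<in> UNIV \<times> {1..l}"
  obtain k j where [simp]: "p = (k, j)" by (cases p)
  define u r where "u = (k - 1) div int d" and "r = (k - 1) mod int d"
  have k: "k = int d * u + r + 1" and r: "0 \<le> r" "r < int d"
    using assms by (auto simp: u_def r_def)
  define m where "m = nat ((int j - 1 + u) mod int l)"
  have "m < l" using assms by (simp add: m_def nat_less_iff)
  then have "d * m + d \<le> l * d" by (metis Suc_leI mult.commute mult_Suc_right mult_le_mono2 add.commute)
  moreover have "nat r < d" using r by (simp add: nat_less_iff)
  moreover have f: "sLR_pos l d p = (u + 1, d * m + nat r + 1)"
    by (simp add: sLR_pos_def u_def r_def m_def Let_def)
  ultimately show "sLR_pos l d p \<in> UNIV \<times> {1..l * d}" by simp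
  show "\<bar>int d * fst (sLR_pos l d p) - 1 * fst p\<bar> \<le> int d"
    unfolding f using r by (simp add: k algebra_simps)
next
  fix y :: "int \<times> nat" assume y: "y \<in> UNIV \<times> {1..l * d}"
  obtain c i where [simp]: "y = (c, i)" by (cases y)
  define m r where "m = (i - 1) div d" and "r = (i - 1) mod d"
  have i: "i = d * m + r + 1" using y by (simp add: m_def r_def)
  have r: "r < d" using assms by (simp add: r_def)
  have m: "m < l" unfolding m_def using y assms by (intro less_mult_imp_div_less) auto
  define u where "u = c - 1"
  have c: "c = u + 1" by (simp add: u_def)
  define j where "j = (int m - u) mod int l"
  have j: "0 \<le> j" "j < int l" using assms by (auto simp: j_def)
  have "(j + u) mod int l = (int m - u + u) mod int l" unfolding j_def by (rule mod_add_left_eq)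
  then have ju: "(j + u) mod int l = int m" using m by simp
  have "(int d * u + int r) div int d = u" "(int d * u + int r) mod int d = int r"
    using r by (auto simp: div_add1_eq mod_pos_pos_trivial div_pos_pos_trivial)
  then have "sLR_pos l d (int d * u + int r + 1, nat j + 1) = y"
    using i j ju c by (simp add: sLR_pos_def Let_def)
  moreover have "(int d * u + int r + 1, nat j + 1) \<in> UNIV \<times> {1..l}"
    using j by (simp add: nat_less_iff Suc_le_eq)
  ultimately show "\<exists>p\<in>UNIV \<times> {1..l}. sLR_pos l d p = y" by blast
qed

lemma abacus_in_abaci: "x \<in> charged_partitions l \<Longrightarrow> abacus x \<in> abaci l"
  using bij_betw_abacus[of l] by (rule bij_betwE[THEN bspec])

lemma LR_in:
  "x \<in> charged_partitions l \<Longrightarrow> l > 0 \<Longrightarrow> e > 0 \<Longrightarrow> LR l e x \<in> charged_partitions e"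
  unfolding LR_def by (intro of_abacus_in LR_pos_abaci abacus_in_abaci)

lemma sLR_in:
  "x \<in> charged_partitions l \<Longrightarrow> l > 0 \<Longrightarrow> d > 0 \<Longrightarrow> sLR l d x \<in> charged_partitions (l * d)"
  unfolding sLR_def by (intro of_abacus_in sLR_pos_abaci abacus_in_abaci)

lemma shift_charge_in:
  "x \<in> charged_partitions l \<Longrightarrow> length v = l \<Longrightarrow> shift_charge v x \<in> charged_partitions l"
  by (auto simp: shift_charge_def charged_partitions_def)

lemma length_rho: "length (rho l) = l"
  by (simp add: rho_def)

lemma length_rho_rev: "length (rho_rev l d) = l * d"
  by (induction l) (simp_all add: rho_rev_def)

end

theory Submission
  imports Defs
begin

text \<open>
  A charged partition is determined by its abacus, so it is enough to compare abaci. There all four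
  maps become maps of positions: \<open>LR\<close> and \<open>sLR\<close> by definition, and a change of the charge because
  it slides each row of the abacus horizontally (\<open>abacus_shift_charge\<close>). The claim thus reduces to an
  identity between two composite maps of positions (\<open>LR_pos_slide_eq_slide_sLR_pos\<close>).

  For that identity let the position \<open>(\<beta>, j)\<close> lie in the domino number \<open>u\<close> of its row at offset \<open>r\<close>,
  that is \<open>\<beta> - 1 = d * u + r\<close> with \<open>0 \<le> r < d\<close>. Sliding row \<open>j\<close> by \<open>d * (j - 1)\<close> moves the position
  by exactly \<open>j - 1\<close> dominoes and keeps \<open>r\<close>. Put \<open>u + (j - 1) = l * q + m\<close> with \<open>0 \<le> m < l\<close>.
  The slid column minus one is \<open>e * q + (d * m + r)\<close>, so \<open>LR\<close> puts the bead into row \<open>d * m + r + 1\<close>,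
  which is also the row that \<open>sLR\<close> assigns to \<open>(\<beta>, j)\<close>: adding \<open>j - 1\<close> to the domino number
  and reducing modulo \<open>l\<close> is the cyclic rotation in the definition of \<open>sLR\<close>. The columns are
  \<open>l * (q + 1) - j + 1 = u + l - m\<close> for \<open>LR\<close> and \<open>u + 1\<close> for \<open>sLR\<close>. They differ by \<open>l - 1 - m\<close>, which
  is the entry of \<open>rho_rev\<close> for that row.
\<close>

definition slide :: "int list \<Rightarrow> int \<times> nat \<Rightarrow> int \<times> nat" where
  "slide v = (\<lambda>(\<beta>, j). (\<beta> + v ! (j - 1), j))"

lemma beta_set_shift: "beta_set \<alpha> (s + c) = (\<lambda>\<beta>. \<beta> + c) ` beta_set \<alpha> s"
  by (simp add: beta_set_range image_image algebra_simps)

text \<open>The charge enters a beta set only as an additive constant, so changing it moves all beads of a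
  row by the same amount.\<close>

lemma abacus_shift_charge:
  assumes "x \<in> charged_partitions l" and "length v = l"
  shows "abacus (shift_charge v x) = slide v ` abacus x"
proof -
  obtain L s where x: "x = (L, s)" by (cases x)
  have len: "length L = l" "length s = l" using assms x by (auto simp: charged_partitions_def)
  have *: "beta_set (L ! (j - 1)) (map2 (+) s v ! (j - 1))
      = (\<lambda>\<beta>. \<beta> + v ! (j - 1)) ` beta_set (L ! (j - 1)) (s ! (j - 1))" if "j \<in> {1..l}" for j
  proof -
    have "j - 1 < l" using that by auto
    then show ?thesis using len assms(2) by (simp flip: beta_set_shift)
  qed
  show ?thesis
    unfolding x shift_charge_def prod.case abacus.simps len
    using * by (fastforce simp: slide_def image_iff)
qed

text \<open>Row \<open>d * m + r + 1\<close> comes from the \<open>m\<close>-th block of \<open>d\<close> equal entries, counted from \<open>0\<close>, and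
  the blocks carry the values \<open>l - 1, l - 2, \<dots>, 0\<close>.\<close>

lemma rho_rev_nth:
  assumes "m < l" and "r < d"
  shows "rho_rev l d ! (d * m + r) = int l - 1 - int m"
  using assms
proof (induction l arbitrary: m)
  case (Suc l)
  have step: "rho_rev (Suc l) d = replicate d (int l) @ rho_rev l d"
    by (simp add: rho_rev_def)
  show ?case
  proof (cases m)
    case 0
    then show ?thesis using Suc by (simp add: step nth_append)
  next
    case (Suc k)
    then show ?thesis using Suc.IH[of k] Suc.prems by (simp add: step nth_append)
  qed
qed simp

text \<open>The combinatorial core: since the slide of row \<open>j\<close> is a whole number of dominoes, the division
  by \<open>l * d\<close> in \<open>LR_pos\<close> splits into the division by \<open>d\<close> and the reduction modulo \<open>l\<close> that
  \<open>sLR_pos\<close> performs one after the other.\<close>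

lemma LR_pos_slide_eq_slide_sLR_pos:
  assumes "d > 0" and j: "j \<in> {1..l}"
  shows "LR_pos l (l * d) (slide (map ((*) (int d)) (rho l)) (\<beta>, j))
    = slide (rho_rev l d) (sLR_pos l d (\<beta>, j))"
proof -
  define u r where "u = (\<beta> - 1) div int d" and "r = (\<beta> - 1) mod int d"
  have \<beta>: "\<beta> - 1 = int d * u + r" and r: "0 \<le> r" "r < int d"
    using assms by (auto simp: u_def r_def)
  define q m where "q = (int j - 1 + u) div int l" and "m = (int j - 1 + u) mod int l"
  have um: "int j - 1 + u = int l * q + m" and m: "0 \<le> m" "m < int l"
    using j by (auto simp: q_def m_def)
  have slid: "slide (map ((*) (int d)) (rho l)) (\<beta>, j) = (\<beta> + int d * (int j - 1), j)"
    using j by (auto simp: slide_def rho_def)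
  \<comment> \<open>The slid column in base \<open>l * d\<close>: its quotient and remainder are read off below.\<close>
  have "\<beta> + int d * (int j - 1) - 1 = int d * (int j - 1 + u) + r"
    using \<beta> by (simp add: algebra_simps)
  also have "\<dots> = int (l * d) * q + (int d * m + r)"
    unfolding um by (simp add: algebra_simps)
  finally have col: "\<beta> + int d * (int j - 1) - 1 = int (l * d) * q + (int d * m + r)" .
  have "int d * m + r < int d * (m + 1)" using r by (simp add: algebra_simps)
  also have "\<dots> \<le> int d * int l" using m by (intro mult_left_mono) auto
  finally have bounds: "0 \<le> int d * m + r" "int d * m + r < int (l * d)"
    using m r by (auto simp: mult.commute)
  have quot: "(\<beta> + int d * (int j - 1) - 1) div int (l * d) = q"
    and rem: "(\<beta> + int d * (int j - 1) - 1) mod int (l * d) = int d * m + r"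
    using int_div_pos_eq[OF col bounds] int_mod_pos_eq[OF col bounds] by blast+
  have row: "nat (int d * m + r) = d * nat m + nat r"
    using m r by (simp add: nat_add_distrib nat_mult_distrib)
  have "LR_pos l (l * d) (slide (map ((*) (int d)) (rho l)) (\<beta>, j))
      = (int l * (q + 1) - int j + 1, d * nat m + nat r + 1)"
    unfolding slid LR_pos_def prod.case quot rem row ..
  also have "int l * (q + 1) - int j + 1 = u + 1 + (int l - 1 - m)"
    using um by (simp add: algebra_simps)
  also have "(u + 1 + (int l - 1 - m), d * nat m + nat r + 1)
      = slide (rho_rev l d) (u + 1, d * nat m + nat r + 1)"
    using rho_rev_nth[of "nat m" l "nat r" d] m r by (simp add: slide_def nat_less_iff)
  also have "(u + 1, d * nat m + nat r + 1) = sLR_pos l d (\<beta>, j)"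
    by (simp add: sLR_pos_def Let_def u_def r_def m_def)
  finally show ?thesis .
qed

theorem proposition2p21:
  fixes l d e :: nat
  assumes "l \<ge> 2" and "d \<ge> 1" and "e = l * d"
  shows "\<forall>x\<in>charged_partitions l.
    (LR l e \<circ> shift_charge (map ((*) (int d)) (rho l))) x = (shift_charge (rho_rev l d) \<circ> sLR l d) x"
proof
  fix x assume x: "x \<in> charged_partitions l"
  have pos: "l > 0" "d > 0" "e > 0" using assms by auto
  let ?v = "map ((*) (int d)) (rho l)"
  have len: "length ?v = l" by (simp add: length_rho)
  have xv: "shift_charge ?v x \<in> charged_partitions l" by (rule shift_charge_in[OF x len])
  have sx: "sLR l d x \<in> charged_partitions e" using sLR_in[OF x] pos assms(3) by simp
  have rows: "abacus x \<subseteq> UNIV \<times> {1..l}" using abacus_in_abaci[OF x] by (simp add: abaci_def)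
  have "abacus (LR l e (shift_charge ?v x)) = LR_pos l e ` slide ?v ` abacus x"
    using LR_pos_abaci[OF abacus_in_abaci[OF xv]] pos
    by (simp add: LR_def abacus_of_abacus abacus_shift_charge[OF x len])
  also have "\<dots> = slide (rho_rev l d) ` sLR_pos l d ` abacus x"
    unfolding image_image assms(3)
    by (rule image_cong) (use rows pos LR_pos_slide_eq_slide_sLR_pos in auto)
  also have "\<dots> = slide (rho_rev l d) ` abacus (sLR l d x)"
    using sLR_pos_abaci[OF abacus_in_abaci[OF x]] pos by (simp add: sLR_def abacus_of_abacus)
  also have "\<dots> = abacus (shift_charge (rho_rev l d) (sLR l d x))"
    using abacus_shift_charge[OF sx] assms(3) by (simp add: length_rho_rev)
  finally have "LR l e (shift_charge ?v x) = shift_charge (rho_rev l d) (sLR l d x)"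
    using bij_betw_imp_inj_on[OF bij_betw_abacus[of e]] LR_in[OF xv] shift_charge_in[OF sx]
      pos assms(3) by (auto dest: inj_onD simp: length_rho_rev)
  then show "(LR l e \<circ> shift_charge ?v) x = (shift_charge (rho_rev l d) \<circ> sLR l d) x" by simp
qed

end
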